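(* Let $G_1$ and $G_2$ be connected graphs on $n_1$ and $n_2$ vertices, respectively, and let $u_1,\dots,u_{n_1}$ be the vertices of $G_1$. Then $$BH(G_1[G_2])=n_1n_2\left(\sum_{i=2}^{n_1}\frac{1}{n_2^2\lambda_i^2(G_1)}+\sum_{j=2}^{n_2}\sum_{i=1}^{n_1}\frac{1}{(\lambda_j(G_2)+d_{G_1}(u_i)n_2)^2}\right).$$
   Context: For a graph $H$ on $k$ vertices, $L(H)=D(H)-A(H)$ is its Laplacian matrix with eigenvalues $0=\lambda_1(H)\le\cdots\le\lambda_k(H)$. The biharmonic index of a connected graph $H$ on $k$ vertices is $BH(H)=\frac12\sum_{u,v}d_B^2(u,v)$ ($d_B^2$ the squared biharmonic distance), equivalently $BH(H)=k\sum_{i=2}^k\lambda_i(H)^{-2}$. $d_{G_1}(u_i)$ is the degree of $u_i$ in $G_1$. The lexicographic product $G_1[G_2]$ has vertex set $V(G_1)\times V(G_2)$, with $(u_i,v_s)$ adjacent to $(u_j,v_t)$ iff either $u_iu_j\in E(G_1)$, or $u_i=u_j$ and $v_sv_t\in E(G_2)$. *)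

theory Defs
  imports "HOL-Analysis.Analysis" "HOL-Computational_Algebra.Computational_Algebra"
begin

(* A graph is given by its adjacency relation; its vertex set is the whole (finite) vertex type. *)
definition simple_graph :: "('a::finite \<Rightarrow> 'a \<Rightarrow> bool) \<Rightarrow> bool" where
  "simple_graph E \<longleftrightarrow> (\<forall>u v. E u v \<longrightarrow> E v u) \<and> (\<forall>u. \<not> E u u)"

definition connected_graph :: "('a::finite \<Rightarrow> 'a \<Rightarrow> bool) \<Rightarrow> bool" where
  "connected_graph E \<longleftrightarrow> simple_graph E \<and> (\<forall>u v. E\<^sup>*\<^sup>* u v)"

definition lex_product ::
  "('a::finite \<Rightarrow> 'a \<Rightarrow> bool) \<Rightarrow> ('b::finite \<Rightarrow> 'b \<Rightarrow> bool) \<Rightarrow> 'a \<times> 'b \<Rightarrow> 'a \<times> 'b \<Rightarrow> bool"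
where
  "lex_product E1 E2 = (\<lambda>(u, v) (u', v'). E1 u u' \<or> (u = u' \<and> E2 v v'))"

definition vertex_degree :: "('a::finite \<Rightarrow> 'a \<Rightarrow> bool) \<Rightarrow> 'a \<Rightarrow> nat" where
  "vertex_degree E u = card {v. E u v}"

definition degree_matrix :: "('a::finite \<Rightarrow> 'a \<Rightarrow> bool) \<Rightarrow> real ^ 'a ^ 'a" where
  "degree_matrix E = (\<chi> u v. if u = v then real (vertex_degree E u) else 0)"

definition adjacency_matrix :: "('a::finite \<Rightarrow> 'a \<Rightarrow> bool) \<Rightarrow> real ^ 'a ^ 'a" where
  "adjacency_matrix E = (\<chi> u v. if E u v then 1 else 0)"

definition laplacian :: "('a::finite \<Rightarrow> 'a \<Rightarrow> bool) \<Rightarrow> real ^ 'a ^ 'a" where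
  "laplacian E = degree_matrix E - adjacency_matrix E"

definition charpoly :: "real ^ 'n ^ 'n \<Rightarrow> real poly" where
  "charpoly A = det (\<chi> i j. (if i = j then [:0, 1:] else 0) - [:A $ i $ j:])"

(* The i-th smallest eigenvalue, counted with multiplicity and indexed from 1 as in
   lambda_1 \<le> ... \<le> lambda_k.  The Laplacian of a simple graph is real symmetric, so all
   CARD('a) roots of its characteristic polynomial are real; the value is only meaningful
   for 1 \<le> i \<le> CARD('a). *)
definition laplacian_eigenvalue :: "('a::finite \<Rightarrow> 'a \<Rightarrow> bool) \<Rightarrow> nat \<Rightarrow> real" where
  "laplacian_eigenvalue E i =
     sorted_list_of_multiset (proots (charpoly (laplacian E))) ! (i - 1)"

(* The four Penrose conditions; the inverse they determine exists and is unique for every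
   real matrix, so the description below is proper. *)
definition is_moore_penrose_inverse :: "real ^ 'n ^ 'm \<Rightarrow> real ^ 'm ^ 'n \<Rightarrow> bool" where
  "is_moore_penrose_inverse A X \<longleftrightarrow>
     A ** X ** A = A \<and> X ** A ** X = X \<and>
     transpose (A ** X) = A ** X \<and> transpose (X ** A) = X ** A"

definition moore_penrose_inverse :: "real ^ 'n ^ 'm \<Rightarrow> real ^ 'm ^ 'n" where
  "moore_penrose_inverse A = (THE X. is_moore_penrose_inverse A X)"

(* The squared biharmonic distance d_B^2(u,v) = (L^2)^+_uu + (L^2)^+_vv - 2 (L^2)^+_uv. *)
definition biharmonic_dist_sq :: "('a::finite \<Rightarrow> 'a \<Rightarrow> bool) \<Rightarrow> 'a \<Rightarrow> 'a \<Rightarrow> real" where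
  "biharmonic_dist_sq E u v =
     (let M = moore_penrose_inverse (laplacian E ** laplacian E)
      in M $ u $ u + M $ v $ v - 2 * M $ u $ v)"

(* Sum over ordered pairs, hence the factor 1/2. *)
definition biharmonic_index :: "('a::finite \<Rightarrow> 'a \<Rightarrow> bool) \<Rightarrow> real" where
  "biharmonic_index E = 1 / 2 * (\<Sum>u\<in>UNIV. \<Sum>v\<in>UNIV. biharmonic_dist_sq E u v)"

end

theory Submission
  imports Defs
begin

text \<open>
  If the columns of an orthogonal matrix \<open>P\<close> are eigenvectors of the Laplacian \<open>L\<close>, with
  eigenvalues \<open>d p\<close>, then \<open>(L\<^sup>2)\<^sup>+\<close> has the same eigenvectors with eigenvalues \<open>1 / (d p)\<^sup>2\<close>
  (and \<open>0\<close> on the kernel) and annihilates the constants, so the biharmonic index is the number of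
  vertices times the trace of \<open>(L\<^sup>2)\<^sup>+\<close>. For \<open>G\<^sub>1[G\<^sub>2]\<close> take orthonormal eigenbases \<open>f\<close> of \<open>L(G\<^sub>1)\<close>
  and \<open>g\<close> of \<open>L(G\<^sub>2)\<close>, where \<open>g\<^sub>1\<close> is constant. Then the \<open>f\<^sub>i \<otimes> g\<^sub>1\<close>, with eigenvalue
  \<open>n\<^sub>2 \<lambda>\<^sub>i(G\<^sub>1)\<close>, together with the \<open>e\<^sub>u \<otimes> g\<^sub>j\<close> for \<open>j \<noteq> 1\<close>, with eigenvalue
  \<open>\<lambda>\<^sub>j(G\<^sub>2) + n\<^sub>2 deg u\<close>, form an orthonormal eigenbasis.
\<close>

no_notation fps_nth (infixl \<open>$\<close> 75)

section \<open>Spectral theorem for real symmetric matrices\<close>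

text \<open>By compactness the quadratic form attains its maximum on the unit sphere of
  \<open>S\<close>, and a maximiser is an eigenvector. An arbitrary invariant \<open>S\<close> is
  allowed so that orthogonal complements of known eigenvectors are covered.\<close>

lemma self_adjoint_eigenvector:
  fixes f :: "'n::euclidean_space \<Rightarrow> 'n"
  assumes "linear f" and sym: "\<And>x y. f x \<bullet> y = x \<bullet> f y"
    and S: "subspace S" "S \<noteq> {0}" and inv: "\<And>x. x \<in> S \<Longrightarrow> f x \<in> S"
  obtains v m where "v \<in> S" "norm v = 1" "f v = m *\<^sub>R v"
proof -
  have "0 \<in> S" using S by (simp add: subspace_0)
  with S obtain x where x: "x \<in> S" "x \<noteq> 0" by blast
  then have "(1 / norm x) *\<^sub>R x \<in> sphere 0 1 \<inter> S"
    using S by (simp add: subspace_scale)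
  then have ne: "sphere 0 1 \<inter> S \<noteq> {}" by blast
  have "compact (sphere 0 1 \<inter> S)"
    using S by (intro compact_Int_closed compact_sphere closed_subspace)
  moreover have "continuous_on (sphere 0 1 \<inter> S) (\<lambda>x. x \<bullet> f x)"
    using \<open>linear f\<close> by (intro continuous_intros linear_continuous_on linear_conv_bounded_linear[THEN iffD1])
  ultimately obtain v where v: "v \<in> sphere 0 1 \<inter> S"
    and sup: "\<And>y. y \<in> sphere 0 1 \<inter> S \<Longrightarrow> y \<bullet> f y \<le> v \<bullet> f v"
    using continuous_attains_sup[OF _ ne] by blast
  txt \<open>At a maximiser \<open>v\<close> of the quadratic form, \<open>g = m - f\<close> is positive semidefinite on \<open>S\<close> and
    its form vanishes at \<open>v\<close>; perturbing \<open>v\<close> along \<open>w = g v\<close> forces \<open>w = 0\<close>.\<close>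
  define m where "m = v \<bullet> f v"
  have vS: "v \<in> S" and nv: "norm v = 1" using v by auto
  have vv: "v \<bullet> v = 1" using nv by (simp add: norm_eq_1)
  define g where "g x = m *\<^sub>R x - f x" for x
  have "linear g" unfolding g_def
    using \<open>linear f\<close> by (intro linear_compose_sub linear_compose_scale_right linear_ident)
  have gsym: "g x \<bullet> y = x \<bullet> g y" for x y
    by (simp add: g_def inner_diff_left inner_diff_right sym)
  have gpos: "0 \<le> y \<bullet> g y" if "y \<in> S" for y
  proof (cases "y = 0")
    case False
    have "(1 / norm y) *\<^sub>R y \<in> sphere 0 1 \<inter> S"
      using S that False by (simp add: subspace_scale)
    from sup[OF this] have "(y \<bullet> f y) / (norm y)\<^sup>2 \<le> m"
      using \<open>linear f\<close> by (simp add: linear_scale m_def power2_eq_square)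
    then have "y \<bullet> f y \<le> m * (y \<bullet> y)"
      using False by (simp add: divide_le_eq power2_norm_eq_inner)
    then show ?thesis by (simp add: g_def inner_diff_right)
  qed simp
  define w where "w = g v"
  have wS: "w \<in> S" unfolding w_def g_def
    using S vS inv by (simp add: subspace_diff subspace_scale)
  define b where "b = w \<bullet> g w"
  have b: "b \<ge> 0" using gpos[OF wS] by (simp add: b_def)
  \<comment> \<open>The \<open>+ 1\<close> keeps the denominator positive when \<open>b = 0\<close>.
    With this \<open>t\<close> the perturbed form equals \<open>- t\<^sup>2 * (b + 2)\<close>, so
    its nonnegativity forces \<open>t = 0\<close>.\<close>
  define t where "t = - (w \<bullet> w) / (b + 1)"
  then have wt: "w \<bullet> w = - t * (b + 1)" using b by simp
  have "0 \<le> (v + t *\<^sub>R w) \<bullet> g (v + t *\<^sub>R w)"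
    using S vS wS by (intro gpos) (simp add: subspace_add subspace_scale)
  also have "\<dots> = v \<bullet> g v + 2 * t * (w \<bullet> w) + t\<^sup>2 * b"
    using \<open>linear g\<close> gsym[of v w]
    by (simp add: linear_add linear_scale inner_add_left inner_add_right b_def w_def[symmetric]
        power2_eq_square algebra_simps)
  also have "v \<bullet> g v = 0"
    by (simp add: g_def inner_diff_right vv m_def)
  finally have 1: "0 \<le> 2 * t * (w \<bullet> w) + t\<^sup>2 * b" by simp
  then have "t\<^sup>2 * (b + 2) \<le> 0"
    unfolding wt by (simp add: algebra_simps power2_eq_square)
  with b have "t = 0"
    by (simp add: mult_le_0_iff)
  with wt have "w = 0" by simp
  then have "f v = m *\<^sub>R v" by (simp add: w_def g_def)
  with vS nv show ?thesis by (rule that)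
qed

section \<open>Diagonal matrices and orthogonal diagonalization\<close>

definition diagonal_matrix :: "('n \<Rightarrow> 'a::zero) \<Rightarrow> 'a ^ 'n ^ 'n" where
  "diagonal_matrix d = (\<chi> i j. if i = j then d i else 0)"

lemma matrix_mult_diagonal_nth [simp]:
  "(P ** diagonal_matrix d) $ i $ j = P $ i $ j * (d j :: 'a::semiring_1)"
  by (simp add: matrix_matrix_mult_def diagonal_matrix_def if_distrib cong: if_cong)

lemma diagonal_matrix_mult:
  "diagonal_matrix d ** diagonal_matrix e = diagonal_matrix (\<lambda>i. d i * (e i :: 'a::semiring_1))"
  by (simp add: vec_eq_iff) (simp add: diagonal_matrix_def)

lemma transpose_diagonal_matrix [simp]: "transpose (diagonal_matrix d) = diagonal_matrix d"
  by (auto simp: transpose_def diagonal_matrix_def vec_eq_iff)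

text \<open>The columns of \<open>P\<close> are an orthonormal eigenbasis. Eigenvalues are indexed,
  without order, by the index type of the matrix, so pairs can index those of a product
  graph.\<close>

definition diagonalizes :: "real ^ 'n ^ 'n \<Rightarrow> ('n \<Rightarrow> real) \<Rightarrow> real ^ 'n ^ 'n \<Rightarrow> bool" where
  "diagonalizes P d A \<longleftrightarrow> orthogonal_matrix P \<and> A ** P = P ** diagonal_matrix d"

lemma diagonalizes_eq:
  assumes "diagonalizes P d A"
  shows "A = P ** diagonal_matrix d ** transpose P"
proof -
  have "A = A ** (P ** transpose P)"
    using assms by (simp add: diagonalizes_def orthogonal_matrix_def)
  also have "\<dots> = A ** P ** transpose P"
    by (simp only: matrix_mul_assoc)
  finally show ?thesis using assms by (simp add: diagonalizes_def)
qed

lemma diagonalizes_nth: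
  assumes "diagonalizes P d A"
  shows "(\<Sum>k\<in>UNIV. A $ i $ k * P $ k $ j) = d j * P $ i $ j"
proof -
  have "(A ** P) $ i $ j = (P ** diagonal_matrix d) $ i $ j"
    using assms by (simp add: diagonalizes_def)
  then show ?thesis by (simp add: matrix_matrix_mult_def[of A P] mult.commute)
qed

lemma orthogonal_matrix_nth:
  fixes P :: "real ^ 'n ^ 'n"
  shows "orthogonal_matrix P \<longleftrightarrow>
    (\<forall>i j. (\<Sum>k\<in>UNIV. P $ k $ i * P $ k $ j) = (if i = j then 1 else 0))"
  by (simp add: orthogonal_matrix vec_eq_iff matrix_matrix_mult_def transpose_def mat_def)

theorem symmetric_matrix_diagonalizable:
  fixes A :: "real ^ 'n ^ 'n"
  assumes sym: "transpose A = A"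
  obtains P d where "diagonalizes P d A"
proof -
  have adj: "(A *v x) \<bullet> y = x \<bullet> (A *v y)" for x y
    by (metis dot_lmul_matrix sym vector_transpose_matrix)
  define good where "good B \<longleftrightarrow> pairwise orthogonal B \<and>
    (\<forall>b\<in>B. norm b = 1 \<and> (\<exists>m. A *v b = m *\<^sub>R b))" for B
  have good_bound: "finite B \<and> card B \<le> CARD('n)" if "good B" for B
  proof -
    have "independent B"
      using that unfolding good_def by (intro pairwise_orthogonal_independent) auto
    from independent_bound[OF this] show ?thesis by simp
  qed
  have "good {}" by (simp add: good_def pairwise_def)
  then obtain B where B: "good B" and max: "\<And>C. good C \<Longrightarrow> card C \<le> card B"
    using ex_has_greatest_nat[of good "{}" card "Suc CARD('n)"] good_bound by (auto simp: less_Suc_eq_le)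
  have finB: "finite B" using good_bound[OF B] by simp
  txt \<open>The orthogonal complement of a maximal orthonormal family of eigenvectors is invariant, so it
    would contain a further eigenvector if it were nontrivial.\<close>
  have "\<not> card B < CARD('n)"
  proof
    assume "card B < CARD('n)"
    then have "dim B < DIM(real ^ 'n)"
      using dim_le_card'[OF finB] by simp
    then obtain x where x: "x \<noteq> 0" "\<And>y. y \<in> span B \<Longrightarrow> orthogonal x y"
      using orthogonal_to_subspace_exists by blast
    define S where "S = {x. \<forall>b\<in>B. x \<bullet> b = 0}"
    have "x \<in> S" using x(2) by (auto simp: S_def orthogonal_def span_base)
    with x have "S \<noteq> {0}" by blast
    moreover have "subspace S"
      by (auto simp: S_def subspace_def inner_add_left)
    moreover have "A *v y \<in> S" if "y \<in> S" for y
    proof -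
      have "(A *v y) \<bullet> b = 0" if "b \<in> B" for b
      proof -
        from B \<open>b \<in> B\<close> obtain m where "A *v b = m *\<^sub>R b" by (auto simp: good_def)
        with \<open>y \<in> S\<close> \<open>b \<in> B\<close> show ?thesis by (simp add: adj S_def)
      qed
      then show ?thesis by (simp add: S_def)
    qed
    ultimately obtain v m where v: "v \<in> S" "norm v = 1" "A *v v = m *\<^sub>R v"
      using self_adjoint_eigenvector[of "(*v) A" S] adj by auto
    then have "good (insert v B)"
      using B by (auto simp: good_def S_def pairwise_insert orthogonal_def inner_commute)
    moreover have "v \<notin> B"
      using v by (auto simp: S_def norm_eq_1)
    ultimately show False using max[of "insert v B"] finB by simp
  qed
  then have "card B = CARD('n)" using good_bound[OF B] by simp
  \<comment> \<open>\<open>B\<close> has exactly as many elements as the index type, so its vectors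
    can serve as the columns of \<open>P\<close>.\<close>
  then obtain h :: "'n \<Rightarrow> real ^ 'n" where h: "bij_betw h UNIV B"
    using finite_same_card_bij[of "UNIV :: 'n set" B] finB by auto
  have hB: "h i \<in> B" for i using h by (auto simp: bij_betw_def)
  then have "\<forall>i. \<exists>m. A *v h i = m *\<^sub>R h i" using B by (auto simp: good_def)
  then obtain d where d: "\<And>i. A *v h i = d i *\<^sub>R h i" by metis
  define P :: "real ^ 'n ^ 'n" where "P = (\<chi> i j. h j $ i)"
  have hh: "h i \<bullet> h j = (if i = j then 1 else 0)" for i j
    using B hB[of i] hB[of j] h
    by (auto simp: good_def pairwise_def orthogonal_def norm_eq_1 bij_betw_def inj_on_eq_iff)
  have "orthogonal_matrix P"
    using hh by (simp add: orthogonal_matrix_nth P_def inner_vec_def)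
  moreover have "A ** P = P ** diagonal_matrix d"
    using d by (simp add: vec_eq_iff matrix_vector_mult_def P_def matrix_matrix_mult_def[of A] mult.commute)
  ultimately show ?thesis using that[of P d] by (simp add: diagonalizes_def)
qed

section \<open>Eigenvalues\<close>

text \<open>The polynomials are compared at each real \<open>x\<close>:
  \<open>(mat x - A) ** P = P ** D\<close> with \<open>D\<close> diagonal, and the nonzero
  \<open>det P\<close> cancels.\<close>

lemma charpoly_diagonalized:
  assumes "diagonalizes P d (A :: real ^ 'n ^ 'n)"
  shows "charpoly A = (\<Prod>i\<in>UNIV. [:- d i, 1:])"
proof -
  have "poly (charpoly A) x = poly (\<Prod>i\<in>UNIV. [:- d i, 1:]) x" for x
  proof -
    define D where "D = diagonal_matrix (\<lambda>i. x - d i)"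
    have orth: "orthogonal_matrix P" using assms by (simp add: diagonalizes_def)
    have "P ** D = x *\<^sub>R P - P ** diagonal_matrix d"
      by (simp add: vec_eq_iff D_def algebra_simps)
    also have "\<dots> = (mat x - A) ** P"
      using assms by (simp add: diagonalizes_def matrix_matrix_mult_def vec_eq_iff mat_def
          left_diff_distrib sum_subtractf if_distrib[of "\<lambda>a. a * _"] cong: if_cong)
    finally have eq: "(mat x - A) ** P = P ** D" ..
    have "det P \<noteq> 0" using det_orthogonal_matrix[OF orth] by auto
    have "poly (charpoly A) x = det (mat x - A)"
      by (simp add: charpoly_def det_def poly_sum poly_prod mat_def if_distrib[of "\<lambda>p. poly p x"]
          of_int_poly cong: if_cong)
    also have "\<dots> = det D"
      using arg_cong[OF eq, of det] \<open>det P \<noteq> 0\<close> by (simp add: det_mul)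
    also have "\<dots> = (\<Prod>i\<in>UNIV. x - d i)"
      unfolding D_def by (subst det_diagonal) (simp_all add: diagonal_matrix_def)
    finally show ?thesis by (simp add: poly_prod)
  qed
  then show ?thesis by (simp add: poly_eq_poly_eq_iff[symmetric] fun_eq_iff)
qed

lemma proots_charpoly_diagonalized:
  assumes "diagonalizes P d (A :: real ^ 'n ^ 'n)"
  shows "proots (charpoly A) = image_mset d (mset_set UNIV)"
proof -
  have "proots (charpoly A) = (\<Sum>i\<in>UNIV. {#d i#})"
    unfolding charpoly_diagonalized[OF assms] by (subst proots_prod) auto
  also have "\<dots> = image_mset d (mset_set UNIV)"
    by (simp add: sum_unfold_sum_mset)
  finally show ?thesis .
qed

text \<open>The sorted roots and the family \<open>d\<close> form the same multiset. This carries
  sums over the ordered eigenvalues to any eigenbasis.\<close>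

lemma sum_laplacian_eigenvalue:
  fixes E :: "'a::finite \<Rightarrow> 'a \<Rightarrow> bool" and g :: "real \<Rightarrow> real"
  assumes "diagonalizes P d (laplacian E)"
  shows "(\<Sum>i = 1..CARD('a). g (laplacian_eigenvalue E i)) = (\<Sum>i\<in>UNIV. g (d i))"
proof -
  define xs where "xs = sorted_list_of_multiset (proots (charpoly (laplacian E)))"
  have mset: "mset xs = image_mset d (mset_set UNIV)"
    by (simp add: xs_def proots_charpoly_diagonalized[OF assms])
  then have len: "length xs = CARD('a)"
    by (metis size_mset size_image_mset size_mset_set)
  have "(\<Sum>i = 1..CARD('a). g (laplacian_eigenvalue E i)) = (\<Sum>i<length xs. g (xs ! i))"
    unfolding len laplacian_eigenvalue_def xs_def[symmetric]
    by (intro sum.reindex_bij_witness[of _ Suc "\<lambda>i. i - 1"]) auto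
  also have "\<dots> = sum_list (map g xs)"
    by (simp add: sum_list_sum_nth atLeast0LessThan)
  also have "\<dots> = sum_mset (image_mset g (mset xs))"
    by (simp flip: sum_mset_sum_list)
  also have "\<dots> = (\<Sum>i\<in>UNIV. g (d i))"
    by (simp add: mset sum_unfold_sum_mset image_mset.compositionality comp_def)
  finally show ?thesis .
qed

section \<open>The biharmonic index\<close>

text \<open>Uniqueness, as \<open>THE\<close> demands: the symmetry conditions give
  \<open>A ** X = A ** Y\<close> and \<open>X ** A = Y ** A\<close>, whence
  \<open>Y = Y ** A ** Y = X ** A ** X = X\<close>.\<close>

lemma moore_penrose_inverse_eqI:
  assumes X: "is_moore_penrose_inverse A X"
  shows "moore_penrose_inverse A = X"
  unfolding moore_penrose_inverse_def
proof (rule the_equality[of "is_moore_penrose_inverse A"])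
  fix Y assume Y: "is_moore_penrose_inverse A Y"
  note XD = X[unfolded is_moore_penrose_inverse_def]
  note YD = Y[unfolded is_moore_penrose_inverse_def]
  have "A ** X = (A ** Y ** A) ** X" using YD by simp
  also have "\<dots> = transpose (A ** Y) ** transpose (A ** X)"
    using XD YD by (simp add: matrix_mul_assoc)
  also have "\<dots> = transpose (A ** X ** A ** Y)"
    by (simp add: matrix_transpose_mul matrix_mul_assoc)
  also have "\<dots> = A ** Y" using XD YD by simp
  finally have 1: "A ** X = A ** Y" .
  have "X ** A = X ** A ** (Y ** A)" using YD by (simp add: matrix_mul_assoc[symmetric])
  also have "\<dots> = transpose (X ** A) ** transpose (Y ** A)"
    using XD YD by simp
  also have "\<dots> = transpose (Y ** (A ** X ** A))"
    by (simp add: matrix_transpose_mul matrix_mul_assoc)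
  also have "\<dots> = Y ** A" using XD YD by simp
  finally have 2: "X ** A = Y ** A" .
  have "Y = Y ** (A ** Y)" using YD by (simp add: matrix_mul_assoc)
  also have "\<dots> = Y ** A ** X" by (simp add: 1[symmetric] matrix_mul_assoc)
  also have "\<dots> = X" using XD by (simp add: 2[symmetric])
  finally show "Y = X" .
qed (rule X)

text \<open>The convention \<open>inverse 0 = 0\<close> makes the pseudoinverse of a diagonal matrix entrywise.\<close>

lemma moore_penrose_inverse_diagonalized:
  fixes P :: "real ^ 'n ^ 'n"
  assumes "orthogonal_matrix P"
  shows "moore_penrose_inverse (P ** diagonal_matrix d ** transpose P) =
    P ** diagonal_matrix (\<lambda>i. inverse (d i)) ** transpose P"
proof (rule moore_penrose_inverse_eqI)
  \<comment> \<open>Matrices diagonalized by the same \<open>P\<close> multiply entrywise on their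
    diagonals, which reduces the Penrose conditions to scalar identities.\<close>
  have mult: "(P ** diagonal_matrix a ** transpose P) ** (P ** diagonal_matrix b ** transpose P) =
    P ** diagonal_matrix (\<lambda>i. a i * b i) ** transpose P" for a b
  proof -
    have "transpose P ** (P ** M) = M" for M :: "real ^ 'n ^ 'n"
      using assms by (simp add: matrix_mul_assoc orthogonal_matrix_def)
    then have "(P ** diagonal_matrix a ** transpose P) ** (P ** diagonal_matrix b ** transpose P) =
      P ** (diagonal_matrix a ** diagonal_matrix b) ** transpose P"
      by (simp flip: matrix_mul_assoc)
    then show ?thesis by (simp only: diagonal_matrix_mult)
  qed
  have tr: "transpose (P ** diagonal_matrix a ** transpose P) = P ** diagonal_matrix a ** transpose P"
    for a
    by (simp add: matrix_transpose_mul matrix_mul_assoc)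
  have inv: "x * inverse x * x = x" "inverse x * x * inverse x = inverse x" for x :: real
    by (cases "x = 0"; simp)+
  show "is_moore_penrose_inverse (P ** diagonal_matrix d ** transpose P)
    (P ** diagonal_matrix (\<lambda>i. inverse (d i)) ** transpose P)"
    unfolding is_moore_penrose_inverse_def mult tr inv by simp
qed

section \<open>Row sums of the Laplacian and the trace formula for the index\<close>

lemma laplacian_nth:
  "laplacian E $ u $ v =
    (if u = v then real (vertex_degree E u) else 0) - (if E u v then 1 else 0)"
  by (simp add: laplacian_def degree_matrix_def adjacency_matrix_def)

lemma vertex_degree_sum:
  "real (vertex_degree E u) = (\<Sum>v\<in>UNIV. if E u v then 1 else 0)"
  by (simp add: vertex_degree_def sum.If_cases)

text \<open>Writing the degree as a sum over neighbours turns the product into differences along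
  edges.\<close>

lemma laplacian_mult_vec_nth:
  "(\<Sum>v\<in>UNIV. laplacian E $ u $ v * x v) =
    (\<Sum>v\<in>UNIV. if E u v then x u - x v else 0)"
proof -
  have "(\<Sum>v\<in>UNIV. laplacian E $ u $ v * x v) =
    (\<Sum>v\<in>UNIV. (if u = v then real (vertex_degree E u) * x v else 0) - (if E u v then x v else 0))"
    by (intro sum.cong) (auto simp: laplacian_nth algebra_simps)
  also have "\<dots> = (\<Sum>v\<in>UNIV. (if E u v then 1 else 0) * x u) - (\<Sum>v\<in>UNIV. if E u v then x v else 0)"
    by (simp add: sum_subtractf vertex_degree_sum sum_distrib_right)
  also have "\<dots> = (\<Sum>v\<in>UNIV. if E u v then x u - x v else 0)"
    unfolding sum_subtractf[symmetric] by (intro sum.cong) auto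
  finally show ?thesis .
qed

lemma laplacian_row_sum [simp]: "(\<Sum>v\<in>UNIV. laplacian E $ u $ v) = 0"
  using laplacian_mult_vec_nth[of E u "\<lambda>_. 1"] by (simp add: if_distrib cong: if_cong)

text \<open>The all-ones vector lies in the kernel, so each eigenvector with nonzero eigenvalue is
  orthogonal to it.\<close>

lemma laplacian_eigenvector_sum:
  assumes P: "diagonalizes P d (laplacian E)"
  shows "d p * (\<Sum>v\<in>UNIV. P $ v $ p) = 0"
proof -
  have "transpose P ** laplacian E = diagonal_matrix d ** transpose P"
    unfolding diagonalizes_eq[OF P] using P
    by (simp add: matrix_mul_assoc diagonalizes_def orthogonal_matrix_def)
  then have "transpose P ** laplacian E *v 1 = diagonal_matrix d ** transpose P *v 1" by simp
  moreover have "laplacian E *v 1 = 0"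
    by (simp add: vec_eq_iff matrix_vector_mult_def)
  ultimately have "(diagonal_matrix d *v (transpose P *v 1)) $ p = 0"
    by (simp flip: matrix_vector_mul_assoc)
  then show ?thesis
    by (simp add: matrix_vector_mult_def diagonal_matrix_def transpose_def
        if_distrib[of "\<lambda>a. a * _"] cong: if_cong)
qed

text \<open>Since \<open>1 / 0 = 0\<close>, kernel vectors do not contribute to the sum.\<close>

lemma biharmonic_index_diagonalized:
  fixes E :: "'a::finite \<Rightarrow> 'a \<Rightarrow> bool"
  assumes P: "diagonalizes P d (laplacian E)"
  shows "biharmonic_index E = real CARD('a) * (\<Sum>p\<in>UNIV. 1 / (d p)\<^sup>2)"
proof -
  define L where "L = laplacian E"
  define e where "e = (\<lambda>p. inverse (d p * d p))"
  define M where "M = P ** diagonal_matrix e ** transpose P"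
  have orth: "orthogonal_matrix P" and LP: "L ** P = P ** diagonal_matrix d"
    using P by (auto simp: diagonalizes_def L_def)
  have "L ** L ** P = P ** diagonal_matrix (\<lambda>p. d p * d p)"
    by (metis LP diagonal_matrix_mult matrix_mul_assoc)
  with orth have "diagonalizes P (\<lambda>p. d p * d p) (L ** L)"
    by (simp add: diagonalizes_def)
  then have "moore_penrose_inverse (L ** L) = M"
    unfolding M_def e_def using diagonalizes_eq moore_penrose_inverse_diagonalized[OF orth] by metis
  then have dist: "biharmonic_dist_sq E u v = M $ u $ u + M $ v $ v - 2 * M $ u $ v" for u v
    by (simp add: biharmonic_dist_sq_def L_def Let_def)
  have M: "M $ u $ v = (\<Sum>p\<in>UNIV. P $ u $ p * e p * P $ v $ p)" for u v
    unfolding M_def by (simp add: matrix_matrix_mult_def[of "_ ** _"] transpose_def)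
  have trace: "(\<Sum>u\<in>UNIV. M $ u $ u) = (\<Sum>p\<in>UNIV. e p)"
  proof -
    have "(\<Sum>u\<in>UNIV. M $ u $ u) = (\<Sum>p\<in>UNIV. e p * (\<Sum>u\<in>UNIV. P $ u $ p * P $ u $ p))"
      unfolding M by (subst sum.swap) (simp add: sum_distrib_left algebra_simps)
    then show ?thesis using orth by (simp add: orthogonal_matrix_nth)
  qed
  \<comment> \<open>For each \<open>p\<close>, either \<open>d p = 0\<close>, and then
    \<open>e p = 0\<close>, or column \<open>p\<close> of \<open>P\<close> sums to zero.\<close>
  have row: "(\<Sum>v\<in>UNIV. M $ u $ v) = 0" for u
  proof -
    have "(\<Sum>v\<in>UNIV. M $ u $ v) = (\<Sum>p\<in>UNIV. P $ u $ p * e p * (\<Sum>v\<in>UNIV. P $ v $ p))"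
      unfolding M by (subst sum.swap) (simp add: sum_distrib_left)
    also have "\<dots> = 0"
      using laplacian_eigenvector_sum[OF P] by (intro sum.neutral) (auto simp: e_def)
    finally show ?thesis .
  qed
  \<comment> \<open>Zero row sums remove the cross terms. The two diagonal terms contribute equally,
    which absorbs the factor \<open>1 / 2\<close>.\<close>
  have "biharmonic_index E =
    1 / 2 * (\<Sum>u\<in>UNIV. real CARD('a) * M $ u $ u + (\<Sum>v\<in>UNIV. M $ v $ v))"
    by (simp add: biharmonic_index_def dist sum.distrib sum_subtractf row flip: sum_distrib_left)
  also have "\<dots> = real CARD('a) * (\<Sum>u\<in>UNIV. M $ u $ u)"
    by (simp add: sum.distrib flip: sum_distrib_left)
  also have "\<dots> = real CARD('a) * (\<Sum>p\<in>UNIV. 1 / (d p)\<^sup>2)"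
    unfolding trace by (simp add: e_def power2_eq_square inverse_eq_divide)
  finally show ?thesis .
qed

section \<open>The Laplacian spectrum\<close>

lemma transpose_laplacian:
  assumes "simple_graph E"
  shows "transpose (laplacian E) = laplacian E"
  using assms by (auto simp: vec_eq_iff transpose_def laplacian_nth simple_graph_def)

text \<open>Exchanging \<open>u\<close> and \<open>v\<close> in the sum of
  \<open>x u * (x u - x v)\<close> and adding both versions completes the square. Ordered pairs
  count each edge twice, hence the division by 2.\<close>

lemma laplacian_quadratic_form:
  assumes "simple_graph E"
  shows "(\<Sum>u\<in>UNIV. x u * (\<Sum>v\<in>UNIV. laplacian E $ u $ v * x v)) =
    (\<Sum>u\<in>UNIV. \<Sum>v\<in>UNIV. if E u v then (x u - x v)\<^sup>2 else 0) / 2"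
proof -
  define T where "T = (\<Sum>u\<in>UNIV. \<Sum>v\<in>UNIV. if E u v then x u * (x u - x v) else 0)"
  have "E u v \<longleftrightarrow> E v u" for u v
    using assms by (auto simp: simple_graph_def)
  then have T': "T = (\<Sum>u\<in>UNIV. \<Sum>v\<in>UNIV. if E u v then x v * (x v - x u) else 0)"
    unfolding T_def by (subst sum.swap) simp
  have "T + T = (\<Sum>u\<in>UNIV. \<Sum>v\<in>UNIV. if E u v then (x u - x v)\<^sup>2 else 0)"
    unfolding T'[symmetric] sum.distrib[symmetric]
    by (subst (2) T', subst T_def, unfold sum.distrib[symmetric])
      (intro sum.cong refl, simp add: power2_eq_square algebra_simps)
  moreover have "(\<Sum>u\<in>UNIV. x u * (\<Sum>v\<in>UNIV. laplacian E $ u $ v * x v)) = T"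
    unfolding laplacian_mult_vec_nth T_def sum_distrib_left by (intro sum.cong) auto
  ultimately show ?thesis by simp
qed

lemma laplacian_spectrum_quadratic_form:
  assumes "simple_graph E" and P: "diagonalizes P d (laplacian E)"
  shows "d i = (\<Sum>u\<in>UNIV. \<Sum>v\<in>UNIV. if E u v then (P $ u $ i - P $ v $ i)\<^sup>2 else 0) / 2"
proof -
  have "(\<Sum>u\<in>UNIV. P $ u $ i * (\<Sum>v\<in>UNIV. laplacian E $ u $ v * P $ v $ i)) =
    d i * (\<Sum>u\<in>UNIV. P $ u $ i * P $ u $ i)"
    unfolding diagonalizes_nth[OF P] by (simp add: sum_distrib_left algebra_simps)
  also have "\<dots> = d i"
    using P by (simp add: diagonalizes_def orthogonal_matrix_nth)
  finally show ?thesis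
    using laplacian_quadratic_form[OF assms(1), of "\<lambda>u. P $ u $ i"] by simp
qed

lemma laplacian_spectrum_nonneg:
  assumes "simple_graph E" and "diagonalizes P d (laplacian E)"
  shows "d i \<ge> 0"
  unfolding laplacian_spectrum_quadratic_form[OF assms] by (auto intro!: sum_nonneg)

text \<open>A zero eigenvalue makes a sum of squares over edges vanish, so the eigenvector agrees
  across every edge and hence along paths.\<close>

lemma connected_graph_kernel_constant:
  assumes "connected_graph E" and P: "diagonalizes P d (laplacian E)" and "d i = 0"
  shows "P $ u $ i = P $ v $ i"
proof -
  have E: "simple_graph E" "E\<^sup>*\<^sup>* u v"
    using assms(1) by (auto simp: connected_graph_def)
  have "(\<Sum>u\<in>UNIV. \<Sum>v\<in>UNIV. if E u v then (P $ u $ i - P $ v $ i)\<^sup>2 else 0) = 0"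
    using laplacian_spectrum_quadratic_form[OF E(1) P, of i] \<open>d i = 0\<close> by simp
  then have edge: "P $ u $ i = P $ v $ i" if "E u v" for u v
    using that by (auto simp: sum_nonneg_eq_0_iff sum_nonneg split: if_splits)
  from E(2) show ?thesis by (induction rule: rtranclp_induct) (auto dest: edge)
qed

text \<open>Otherwise every column of \<open>P\<close> would sum to zero, and so would each row of
  \<open>P ** transpose P\<close>, the identity matrix.\<close>

lemma laplacian_singular:
  assumes P: "diagonalizes P d (laplacian E)"
  obtains i where "d i = 0"
proof (rule ccontr)
  assume "\<not> thesis"
  with that have "\<And>i. d i \<noteq> 0" by blast
  with laplacian_eigenvector_sum[OF P] have z: "(\<Sum>v\<in>UNIV. P $ v $ p) = 0" for p
    by simp
  fix u
  have "(P ** transpose P) $ u $ v = mat 1 $ u $ v" for v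
    using P by (simp add: diagonalizes_def orthogonal_matrix_def)
  then have "(\<Sum>v\<in>UNIV. \<Sum>p\<in>UNIV. P $ u $ p * P $ v $ p) = 1"
    by (simp add: matrix_matrix_mult_def transpose_def mat_def)
  moreover have "(\<Sum>v\<in>UNIV. \<Sum>p\<in>UNIV. P $ u $ p * P $ v $ p) = 0"
    by (subst sum.swap) (simp add: z flip: sum_distrib_left)
  ultimately show False by simp
qed

text \<open>All entries of the sorted list are nonnegative and 0 occurs among them, so it comes
  first.\<close>

lemma laplacian_eigenvalue_1:
  fixes E :: "'a::finite \<Rightarrow> 'a \<Rightarrow> bool"
  assumes "simple_graph E" and P: "diagonalizes P d (laplacian E)"
  shows "laplacian_eigenvalue E 1 = 0"
proof -
  define xs where "xs = sorted_list_of_multiset (proots (charpoly (laplacian E)))"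
  have "mset xs = image_mset d (mset_set UNIV)"
    by (simp add: xs_def proots_charpoly_diagonalized[OF P])
  then have set: "set xs = range d"
    by (metis finite_class.finite_UNIV finite_set_mset_mset_set set_image_mset set_mset_mset)
  obtain i where "d i = 0" using laplacian_singular[OF P] .
  with set obtain k where k: "k < length xs" "xs ! k = 0"
    by (metis in_set_conv_nth rangeI)
  have "sorted xs" by (simp add: xs_def)
  with k have "xs ! 0 \<le> 0" by (metis sorted_nth_mono zero_le)
  moreover have "xs ! 0 \<in> range d"
    unfolding set[symmetric] using k by (intro nth_mem) linarith
  ultimately show ?thesis
    using laplacian_spectrum_nonneg[OF assms]
    by (auto simp: laplacian_eigenvalue_def xs_def[symmetric] intro!: antisym)
qed

text \<open>Exactly one zero is dropped on each side, index 1 on the left and \<open>i0\<close> on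
  the right, so the multiplicity of 0 does not matter.\<close>

lemma sum_laplacian_eigenvalue_tail:
  fixes E :: "'a::finite \<Rightarrow> 'a \<Rightarrow> bool" and g :: "real \<Rightarrow> real"
  assumes "simple_graph E" and P: "diagonalizes P d (laplacian E)" and i0: "d i0 = 0"
  shows "(\<Sum>i = 2..CARD('a). g (laplacian_eigenvalue E i)) = (\<Sum>i\<in>UNIV - {i0}. g (d i))"
proof -
  have "(\<Sum>i = 1..CARD('a). g (laplacian_eigenvalue E i)) =
    g 0 + (\<Sum>i = 2..CARD('a). g (laplacian_eigenvalue E i))"
    using laplacian_eigenvalue_1[OF assms(1) P]
    by (subst sum.atLeast_Suc_atMost) (simp_all add: Suc_leI numeral_2_eq_2)
  moreover have "(\<Sum>i\<in>UNIV. g (d i)) = g 0 + (\<Sum>i\<in>UNIV - {i0}. g (d i))"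
    by (subst sum.remove[of _ i0]) (simp_all add: i0)
  ultimately show ?thesis
    using sum_laplacian_eigenvalue[OF P, of g] by simp
qed

section \<open>Lexicographic products\<close>

lemma sum_UNIV_prod:
  "(\<Sum>p\<in>UNIV. f p) = (\<Sum>u\<in>UNIV. \<Sum>v\<in>UNIV. f (u :: 'a::finite, v :: 'b::finite))"
  by (simp add: sum.cartesian_product flip: UNIV_Times_UNIV)

text \<open>A neighbour lies either in one of the full copies of the second graph over neighbours of
  \<open>u\<close> or in the same copy; irreflexivity of \<open>E1\<close> makes the cases
  disjoint.\<close>

lemma vertex_degree_lex_product:
  fixes E2 :: "'b::finite \<Rightarrow> 'b \<Rightarrow> bool"
  assumes "simple_graph E1"
  shows "real (vertex_degree (lex_product E1 E2) (u, v)) =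
    real CARD('b) * real (vertex_degree E1 u) + real (vertex_degree E2 v)"
proof -
  have "real (vertex_degree (lex_product E1 E2) (u, v)) =
    (\<Sum>u'\<in>UNIV. \<Sum>v'\<in>UNIV. (if E1 u u' then 1 else 0) + (if u = u' then if E2 v v' then 1 else 0 else 0))"
    unfolding vertex_degree_sum sum_UNIV_prod
    using assms by (intro sum.cong) (auto simp: lex_product_def simple_graph_def)
  also have "\<dots> = (\<Sum>u'\<in>UNIV. real CARD('b) * (if E1 u u' then 1 else 0) +
      (if u = u' then real (vertex_degree E2 v) else 0))"
    by (intro sum.cong) (auto simp: sum.distrib vertex_degree_sum)
  also have "\<dots> = real CARD('b) * real (vertex_degree E1 u) + real (vertex_degree E2 v)"
    by (simp add: sum.distrib vertex_degree_sum sum_distrib_left)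
  finally show ?thesis .
qed

text \<open>With \<open>J\<close> the all-ones matrix and \<open>D1\<close> the degree matrix of
  \<open>E1\<close>, this is
  \<open>L1 \<otimes> J + I \<otimes> L2 + D1 \<otimes> (n2 I - J)\<close>.\<close>

lemma laplacian_lex_product_nth:
  fixes E2 :: "'b::finite \<Rightarrow> 'b \<Rightarrow> bool"
  assumes "simple_graph E1"
  shows "laplacian (lex_product E1 E2) $ (u, v) $ (u', v') =
    laplacian E1 $ u $ u' +
    (if u = u' then laplacian E2 $ v $ v' - real (vertex_degree E1 u) +
      (if v = v' then real CARD('b) * real (vertex_degree E1 u) else 0) else 0)"
  using assms vertex_degree_lex_product[OF assms, of E2 u v]
  by (auto simp: laplacian_nth lex_product_def simple_graph_def)

text \<open>The three terms come from the three Kronecker summands. The last vanishes for constant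
  \<open>y\<close>, the first for \<open>y\<close> with sum zero.\<close>

lemma laplacian_lex_product_mult_tensor:
  fixes E2 :: "'b::finite \<Rightarrow> 'b \<Rightarrow> bool"
  assumes "simple_graph E1"
  shows "(\<Sum>p\<in>UNIV. laplacian (lex_product E1 E2) $ (u, v) $ p * (x (fst p) * y (snd p))) =
    (\<Sum>u'\<in>UNIV. laplacian E1 $ u $ u' * x u') * (\<Sum>v'\<in>UNIV. y v') +
    x u * (\<Sum>v'\<in>UNIV. laplacian E2 $ v $ v' * y v') +
    real (vertex_degree E1 u) * x u * (real CARD('b) * y v - (\<Sum>v'\<in>UNIV. y v'))"
proof -
  let ?\<delta> = "real (vertex_degree E1 u)"
  have "(\<Sum>p\<in>UNIV. laplacian (lex_product E1 E2) $ (u, v) $ p * (x (fst p) * y (snd p))) =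
    (\<Sum>u'\<in>UNIV. \<Sum>v'\<in>UNIV. laplacian E1 $ u $ u' * x u' * y v' +
      (if u = u' then x u * (laplacian E2 $ v $ v' * y v') - ?\<delta> * x u * y v' +
        (if v = v' then ?\<delta> * x u * (real CARD('b) * y v) else 0) else 0))"
    unfolding sum_UNIV_prod laplacian_lex_product_nth[OF assms]
    by (intro sum.cong) (auto simp: algebra_simps)
  also have "\<dots> = (\<Sum>u'\<in>UNIV. laplacian E1 $ u $ u' * x u' * (\<Sum>v'\<in>UNIV. y v') +
      (if u = u' then x u * (\<Sum>v'\<in>UNIV. laplacian E2 $ v $ v' * y v') - ?\<delta> * x u * (\<Sum>v'\<in>UNIV. y v') +
        ?\<delta> * x u * (real CARD('b) * y v) else 0))"
    by (intro sum.cong) (auto simp: sum.distrib sum_subtractf sum_distrib_left)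
  also have "\<dots> = (\<Sum>u'\<in>UNIV. laplacian E1 $ u $ u' * x u') * (\<Sum>v'\<in>UNIV. y v') +
    x u * (\<Sum>v'\<in>UNIV. laplacian E2 $ v $ v' * y v') +
    ?\<delta> * x u * (real CARD('b) * y v - (\<Sum>v'\<in>UNIV. y v'))"
    by (simp add: sum.distrib flip: sum_distrib_right) (simp add: algebra_simps)
  finally show ?thesis .
qed

text \<open>Column \<open>(i, j)\<close> is column \<open>i\<close> of \<open>Q j\<close> tensored
  with column \<open>j\<close> of \<open>P2\<close>. Away from \<open>j0\<close> only the degree
  matrix acts on the first factor, so the standard basis serves there.\<close>

lemma lex_product_diagonalizes:
  fixes E1 :: "'a::finite \<Rightarrow> 'a \<Rightarrow> bool" and E2 :: "'b::finite \<Rightarrow> 'b \<Rightarrow> bool"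
  assumes "simple_graph E1"
    and P1: "diagonalizes P1 d1 (laplacian E1)" and P2: "diagonalizes P2 d2 (laplacian E2)"
    and j0: "d2 j0 = 0" and const: "\<And>v w. P2 $ v $ j0 = P2 $ w $ j0"
  defines "Q \<equiv> (\<lambda>j. if j = j0 then P1 else mat 1)"
  shows "diagonalizes (\<chi> p q. Q (snd q) $ fst p $ fst q * P2 $ snd p $ snd q)
    (\<lambda>(i, j). if j = j0 then real CARD('b) * d1 i
      else d2 j + real (vertex_degree E1 i) * real CARD('b))
    (laplacian (lex_product E1 E2))" (is "diagonalizes ?P ?d _")
proof -
  have orth1: "(\<Sum>u\<in>UNIV. P1 $ u $ i * P1 $ u $ i') = (if i = i' then 1 else 0)" for i i'
    using P1 by (simp add: diagonalizes_def orthogonal_matrix_nth)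
  have orth2: "(\<Sum>v\<in>UNIV. P2 $ v $ j * P2 $ v $ j') = (if j = j' then 1 else 0)" for j j'
    using P2 by (simp add: diagonalizes_def orthogonal_matrix_nth)
  have orthQ: "(\<Sum>u\<in>UNIV. Q j $ u $ i * Q j $ u $ i') = (if i = i' then 1 else 0)" for i i' j
    by (simp add: Q_def orth1 mat_def if_distrib[of "\<lambda>a. a * _"] cong: if_cong)
  have "(\<Sum>p\<in>UNIV. ?P $ p $ (i, j) * ?P $ p $ (i', j')) = (if (i, j) = (i', j') then 1 else 0)"
    for i j i' j'
  proof -
    \<comment> \<open>The inner product factors. For \<open>j \<noteq> j'\<close> the second factor
      vanishes whatever \<open>Q\<close> is; for \<open>j = j'\<close> orthogonality of
      \<open>Q j\<close> decides.\<close>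
    have "(\<Sum>p\<in>UNIV. ?P $ p $ (i, j) * ?P $ p $ (i', j')) =
      (\<Sum>u\<in>UNIV. Q j $ u $ i * Q j' $ u $ i') * (\<Sum>v\<in>UNIV. P2 $ v $ j * P2 $ v $ j')"
      unfolding sum_UNIV_prod sum_product by (simp add: algebra_simps)
    also have "\<dots> = (if (i, j) = (i', j') then 1 else 0)"
      by (cases "j = j'") (simp_all add: orthQ orth2)
    finally show ?thesis .
  qed
  then have "orthogonal_matrix ?P"
    unfolding orthogonal_matrix_nth split_paired_All by blast
  moreover have "(laplacian (lex_product E1 E2) ** ?P) $ (u, v) $ (i, j) =
    (?P ** diagonal_matrix ?d) $ (u, v) $ (i, j)" for u v i j
  proof -
    let ?s = "\<Sum>v'\<in>UNIV. P2 $ v' $ j"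
    have "(laplacian (lex_product E1 E2) ** ?P) $ (u, v) $ (i, j) =
      (\<Sum>u'\<in>UNIV. laplacian E1 $ u $ u' * Q j $ u' $ i) * ?s +
      Q j $ u $ i * (d2 j * P2 $ v $ j) +
      real (vertex_degree E1 u) * Q j $ u $ i * (real CARD('b) * P2 $ v $ j - ?s)"
      using laplacian_lex_product_mult_tensor[OF assms(1),
          of E2 u v "\<lambda>u. Q j $ u $ i" "\<lambda>v. P2 $ v $ j"]
      by (simp add: matrix_matrix_mult_def diagonalizes_nth[OF P2])
    also have "\<dots> = ?P $ (u, v) $ (i, j) * ?d (i, j)"
    proof (cases "j = j0")
      case True
      have "?s = (\<Sum>v'\<in>(UNIV :: 'b set). P2 $ v $ j)"
        unfolding True by (intro sum.cong refl const)
      then show ?thesis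
        by (simp add: True Q_def diagonalizes_nth[OF P1] j0)
    next
      case False
      \<comment> \<open>Column \<open>j\<close> is orthogonal to column \<open>j0\<close>, a nonzero
        constant vector, so its entries sum to zero.\<close>
      have "P2 $ v $ j0 * ?s = (\<Sum>v'\<in>UNIV. P2 $ v' $ j0 * P2 $ v' $ j)" for v
        unfolding sum_distrib_left by (intro sum.cong refl arg_cong2[of _ _ _ _ "(*)"] const)
      with False have s0: "P2 $ v $ j0 * ?s = 0" for v by (simp add: orth2)
      have "P2 $ v $ j0 \<noteq> 0" for v
      proof
        assume "P2 $ v $ j0 = 0"
        then have "P2 $ w $ j0 = 0" for w using const by metis
        then show False using orth2[of j0 j0] by simp
      qed
      with s0 have "?s = 0" by (meson mult_eq_0_iff)
      then show ?thesis
        using False by (simp add: Q_def mat_def algebra_simps)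
    qed
    finally show ?thesis by simp
  qed
  then have "laplacian (lex_product E1 E2) ** ?P = ?P ** diagonal_matrix ?d"
    unfolding vec_eq_iff split_paired_All by blast
  ultimately show ?thesis by (simp add: diagonalizes_def)
qed

theorem theorem6p4:
  fixes E1 :: "'a::finite \<Rightarrow> 'a \<Rightarrow> bool"
    and E2 :: "'b::finite \<Rightarrow> 'b \<Rightarrow> bool"
    and n1 n2 :: nat
  assumes "connected_graph E1" and "connected_graph E2"
    and "n1 = CARD('a)" and "n2 = CARD('b)"
  shows "biharmonic_index (lex_product E1 E2) =
    real n1 * real n2 *
      ((\<Sum>i = 2..n1. 1 / ((real n2)\<^sup>2 * (laplacian_eigenvalue E1 i)\<^sup>2)) +
       (\<Sum>j = 2..n2. \<Sum>u\<in>UNIV.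
          1 / (laplacian_eigenvalue E2 j + real (vertex_degree E1 u) * real n2)\<^sup>2))"
proof -
  have simple: "simple_graph E1" "simple_graph E2"
    using assms by (auto simp: connected_graph_def)
  obtain P1 d1 where P1: "diagonalizes P1 d1 (laplacian E1)"
    using symmetric_matrix_diagonalizable[OF transpose_laplacian[OF simple(1)]] .
  obtain P2 d2 where P2: "diagonalizes P2 d2 (laplacian E2)"
    using symmetric_matrix_diagonalizable[OF transpose_laplacian[OF simple(2)]] .
  obtain i0 where i0: "d1 i0 = 0" using laplacian_singular[OF P1] .
  obtain j0 where j0: "d2 j0 = 0" using laplacian_singular[OF P2] .
  define d where "d = (\<lambda>(i, j). if j = j0 then real n2 * d1 i
    else d2 j + real (vertex_degree E1 i) * real n2)"
  have "biharmonic_index (lex_product E1 E2) = real n1 * real n2 * (\<Sum>p\<in>UNIV. 1 / (d p)\<^sup>2)"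
    using biharmonic_index_diagonalized[OF lex_product_diagonalizes[OF simple(1) P1 P2 j0
          connected_graph_kernel_constant[OF assms(2) P2 j0]]]
    unfolding d_def assms(3,4) by simp
  also have "(\<Sum>p\<in>UNIV. 1 / (d p)\<^sup>2) = (\<Sum>i\<in>UNIV. 1 / ((real n2)\<^sup>2 * (d1 i)\<^sup>2)) +
    (\<Sum>i\<in>UNIV. \<Sum>j\<in>UNIV - {j0}. 1 / (d2 j + real (vertex_degree E1 i) * real n2)\<^sup>2)"
  proof -
    have "(\<Sum>j\<in>UNIV. 1 / (d (i, j))\<^sup>2) = 1 / ((real n2)\<^sup>2 * (d1 i)\<^sup>2) +
      (\<Sum>j\<in>UNIV - {j0}. 1 / (d2 j + real (vertex_degree E1 i) * real n2)\<^sup>2)" for i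
      by (subst sum.remove[of _ j0]) (auto simp: d_def power_mult_distrib intro!: sum.cong)
    then show ?thesis by (simp add: sum_UNIV_prod sum.distrib)
  qed
  \<comment> \<open>The term at \<open>i0\<close> is \<open>1 / 0 = 0\<close>, so removing it
    changes nothing.\<close>
  also have "(\<Sum>i\<in>UNIV. 1 / ((real n2)\<^sup>2 * (d1 i)\<^sup>2)) =
    (\<Sum>i\<in>UNIV - {i0}. 1 / ((real n2)\<^sup>2 * (d1 i)\<^sup>2))"
    by (subst sum.remove[of _ i0]) (simp_all add: i0)
  also have "\<dots> = (\<Sum>i = 2..n1. 1 / ((real n2)\<^sup>2 * (laplacian_eigenvalue E1 i)\<^sup>2))"
    unfolding assms(3) using sum_laplacian_eigenvalue_tail[OF simple(1) P1 i0,
        of "\<lambda>x. 1 / ((real n2)\<^sup>2 * x\<^sup>2)"] by simp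
  \<comment> \<open>After exchanging the sums, the whole sum over \<open>u\<close> is one function
    of the eigenvalue, to which the tail formula applies.\<close>
  also have "(\<Sum>i\<in>UNIV. \<Sum>j\<in>UNIV - {j0}. 1 / (d2 j + real (vertex_degree E1 i) * real n2)\<^sup>2) =
    (\<Sum>j = 2..n2. \<Sum>u\<in>UNIV.
      1 / (laplacian_eigenvalue E2 j + real (vertex_degree E1 u) * real n2)\<^sup>2)"
    by (subst sum.swap) (use sum_laplacian_eigenvalue_tail[OF simple(2) P2 j0,
          of "\<lambda>x. \<Sum>u\<in>UNIV. 1 / (x + real (vertex_degree E1 u) * real n2)\<^sup>2"] assms(4) in simp)
  finally show ?thesis .
qed

end
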